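(* Let $X,Y$ be complex Hilbert spaces, let $N\in\mathbb{N}$, let $f_1,\dots,f_N\in Y$ be measurements, let $A_1,\dots,A_N:X\to Y$ be nonlinear mappings, let $R:Y\to Y$ be a bounded, self-adjoint, positive definite operator with bounded inverse, let $\varphi_0\in X$ be the initial guess and $\alpha_0>0$ the initial regularization parameter. Let $(\varphi^{FLM}_i)_{i\in\mathbb{N}_0}$ be the Full data Levenberg--Marquardt iteration and $(\varphi^{KFL}_{i,n})_{i\in\mathbb{N}_0,\,0\le n\le N}$ the Kalman filter Levenberg--Marquardt iteration, both defined in the context, started from $\varphi_0$ and run with the same regularization parameters $(\alpha_i)_{i\in\mathbb{N}_0}$. Then the two iterations are equivalent, that is, $$\varphi^{KFL}_{i,N}=\varphi^{FLM}_{i+1}\qquad\text{for all } i\in\mathbb{N}_0 .$$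
   Context: The mappings $A_n$ are assumed to be Fréchet differentiable at every point at which a derivative is evaluated below; $A_n'[\varphi]:X\to Y$ denotes the Fréchet derivative of $A_n$ at $\varphi$ (a bounded linear operator). A superscript $H$ denotes the Hilbert space adjoint with respect to the usual (unweighted) scalar products of $X$, $Y$, $Y^N$. Set $$\vec f=(f_1,\dots,f_N)^T\in Y^N,\quad \vec A(\varphi)=(A_1(\varphi),\dots,A_N(\varphi))^T,\quad \vec A'[\varphi]=(A_1'[\varphi],\dots,A_N'[\varphi])^T:X\to Y^N,$$ and let $R^{-1}$ act on $Y^N$ componentwise, i.e. as the block diagonal operator $\mathrm{diag}(R^{-1},\dots,R^{-1})$. Full data Levenberg--Marquardt: $\varphi^{FLM}_0:=\varphi_0$ and, for $i\in\mathbb{N}_0$, $$\varphi^{FLM}_{i+1}:=\varphi^{FLM}_{i}+\left(\alpha_i I+\vec A'[\varphi^{FLM}_i]^{H}R^{-1}\vec A'[\varphi^{FLM}_i]\right)^{-1}\vec A'[\varphi^{FLM}_i]^{H}R^{-1}\left(\vec f-\vec A(\varphi^{FLM}_i)\right).$$ Regularization parameters: $\alpha_0>0$ is given, and for $i\ge1$ the parameter $\alpha_i>0$ is chosen to satisfy the Morozov discrepancy principle $$\left\|\vec f-\vec A(\varphi^{FLM}_i)-\vec A'[\varphi^{FLM}_i]\left(\varphi_{i+1}(\alpha_i)-\varphi^{FLM}_i\right)\right\|=\rho\left\|\vec f-\vec A(\varphi^{FLM}_i)\right\|$$ with a fixed $\rho\in(0,1)$, where $\varphi_{i+1}(\alpha)$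 is the right-hand side of the update formula for $\varphi^{FLM}_{i+1}$ with $\alpha_i$ replaced by $\alpha$, and the norm is the one on $Y^N$ induced by the scalar product $\langle\cdot,R^{-1}\cdot\rangle_{Y^N}$. Kalman filter Levenberg--Marquardt: $\varphi^{KFL}_{0,0}:=\varphi_0$, and $\varphi^{KFL}_{i,0}:=\varphi^{KFL}_{i-1,N}$ for $i\ge1$; $B_{i,0}:=\frac1{\alpha_i}I$ (an operator on $X$) for all $i\in\mathbb{N}_0$; and for $i\in\mathbb{N}_0$, $n=1,\dots,N$, $$\varphi^{KFL}_{i,n}:=\varphi^{KFL}_{i,n-1}+K_{i,n}\left(f_n-A_n(\varphi^{KFL}_{i,0})+A_n'[\varphi^{KFL}_{i,0}]\varphi^{KFL}_{i,0}-A_n'[\varphi^{KFL}_{i,0}]\varphi^{KFL}_{i,n-1}\right),$$ $$K_{i,n}:=B_{i,n-1}A_n'[\varphi^{KFL}_{i,0}]^{H}\left(R+A_n'[\varphi^{KFL}_{i,0}]B_{i,n-1}A_n'[\varphi^{KFL}_{i,0}]^{H}\right)^{-1},$$ $$B_{i,n}:=\left(I-K_{i,n}A_n'[\varphi^{KFL}_{i,0}]\right)B_{i,n-1}.$$ *)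

theory Defs
  imports "HOL-Analysis.Analysis"
begin

section \<open>Complex Hilbert spaces\<close>

text \<open>
  The underlying real Banach space comes from the library; the scalar product is linear in its
  first argument. Positive definiteness of the scalar product is contained in the last axiom,
  which says that the norm is the one it induces.
\<close>

class complex_hilbert = banach +
  fixes scaleC :: "complex \<Rightarrow> 'a \<Rightarrow> 'a"  (infixr \<open>*\<^sub>C\<close> 75)
    and cinner :: "'a \<Rightarrow> 'a \<Rightarrow> complex"
  assumes scaleC_add_right: "c *\<^sub>C (x + y) = c *\<^sub>C x + c *\<^sub>C y"
    and scaleC_add_left: "(c + d) *\<^sub>C x = c *\<^sub>C x + d *\<^sub>C x"
    and scaleC_scaleC: "c *\<^sub>C d *\<^sub>C x = (c * d) *\<^sub>C x"
    and scaleC_of_real: "complex_of_real r *\<^sub>C x = r *\<^sub>R x"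
    and cinner_add_left: "cinner (x + y) z = cinner x z + cinner y z"
    and cinner_scaleC_left: "cinner (c *\<^sub>C x) y = c * cinner x y"
    and cinner_commute: "cinner x y = cnj (cinner y x)"
    and cinner_self: "cinner x x = complex_of_real ((norm x)\<^sup>2)"

instantiation complex :: complex_hilbert
begin

definition scaleC_complex :: "complex \<Rightarrow> complex \<Rightarrow> complex"
  where "scaleC_complex c x = c * x"

definition cinner_complex :: "complex \<Rightarrow> complex \<Rightarrow> complex"
  where "cinner_complex x y = x * cnj y"

instance
proof
  fix x :: complex
  show "cinner x x = complex_of_real ((norm x)\<^sup>2)"
    unfolding cinner_complex_def by (rule complex_norm_square [symmetric])
qed (simp_all add: scaleC_complex_def cinner_complex_def ring_distribs scaleR_conv_of_real)

end

lemma cinner_eqI: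
  assumes "\<And>x::'a::complex_hilbert. cinner x u = cinner x v"
  shows "u = v"
proof -
  have "cinner u (u - v) = cinner v (u - v)"
    using arg_cong[OF assms[of "u - v"], of cnj]
    by (simp only: cinner_commute[symmetric])
  moreover have "cinner u (u - v) = cinner (u - v) (u - v) + cinner v (u - v)"
    using cinner_add_left[of "u - v" v "u - v"] by simp
  ultimately have "cinner (u - v) (u - v) = 0" by simp
  then have "complex_of_real ((norm (u - v))\<^sup>2) = 0" by (simp only: cinner_self)
  then show ?thesis by simp
qed

definition bounded_clinear :: "('a::complex_hilbert \<Rightarrow> 'b::complex_hilbert) \<Rightarrow> bool"
  where "bounded_clinear T \<longleftrightarrow> bounded_linear T \<and> (\<forall>c x. T (c *\<^sub>C x) = c *\<^sub>C T x)"

text \<open>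
  Frechet differentiability over the complex numbers: the derivative is complex linear.
  The derivative itself is then the library's \<open>frechet_derivative F (at x)\<close>.
\<close>

definition cfrechet_differentiable ::
    "('a::complex_hilbert \<Rightarrow> 'b::complex_hilbert) \<Rightarrow> 'a \<Rightarrow> bool"
  where "cfrechet_differentiable F x \<longleftrightarrow> (\<exists>D. bounded_clinear D \<and> (F has_derivative D) (at x))"

text \<open>
  Adjoint of an operator whose target carries the scalar product \<open>s\<close>; the parameter \<open>s\<close> lets
  one definition serve both \<open>X \<rightarrow> Y\<close> and \<open>X \<rightarrow> Y\<^sup>N\<close>.
\<close>

definition adjoint_wrt ::
    "('v \<Rightarrow> 'v \<Rightarrow> complex) \<Rightarrow> ('x::complex_hilbert \<Rightarrow> 'v) \<Rightarrow> 'v \<Rightarrow> 'x"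
  where "adjoint_wrt s T = (THE S. \<forall>x y. s (T x) y = cinner x (S y))"

abbreviation cadjoint :: "('x::complex_hilbert \<Rightarrow> 'y::complex_hilbert) \<Rightarrow> 'y \<Rightarrow> 'x"
  where "cadjoint \<equiv> adjoint_wrt cinner"

lemma adjoint_wrt_eqI:
  assumes "\<And>x y. s (T x) y = cinner x (S y)"
  shows "adjoint_wrt s T = S"
  unfolding adjoint_wrt_def
proof (rule the_equality)
  fix S' assume "\<forall>x y. s (T x) y = cinner x (S' y)"
  with assms have "cinner x (S' y) = cinner x (S y)" for x y by simp
  then have "S' y = S y" for y by (rule cinner_eqI)
  then show "S' = S" by blast
qed (use assms in blast)

definition positive_definite :: "('y::complex_hilbert \<Rightarrow> 'y) \<Rightarrow> bool"
  where "positive_definite T \<longleftrightarrow> (\<forall>y. y \<noteq> 0 \<longrightarrow> cinner (T y) y \<in> \<real> \<and> Re (cinner (T y) y) > 0)"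

section \<open>The product space\<close>

text \<open>
  Elements of \<open>Y\<^sup>N\<close> are functions on the natural numbers of which only the components with
  indices \<open>1, \<dots>, N\<close> count.
\<close>

definition cinner_tuple :: "nat \<Rightarrow> (nat \<Rightarrow> 'y::complex_hilbert) \<Rightarrow> (nat \<Rightarrow> 'y) \<Rightarrow> complex"
  where "cinner_tuple N g h = (\<Sum>n = 1..N. cinner (g n) (h n))"

abbreviation cadjoint_tuple ::
    "nat \<Rightarrow> ('x::complex_hilbert \<Rightarrow> nat \<Rightarrow> 'y::complex_hilbert) \<Rightarrow> (nat \<Rightarrow> 'y) \<Rightarrow> 'x"
  where "cadjoint_tuple N \<equiv> adjoint_wrt (cinner_tuple N)"

definition diag_inv :: "('y \<Rightarrow> 'y) \<Rightarrow> (nat \<Rightarrow> 'y) \<Rightarrow> nat \<Rightarrow> 'y"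
  where "diag_inv R g = (\<lambda>n. inv R (g n))"

definition weighted_norm :: "nat \<Rightarrow> ('y::complex_hilbert \<Rightarrow> 'y) \<Rightarrow> (nat \<Rightarrow> 'y) \<Rightarrow> real"
  where "weighted_norm N R g = sqrt (Re (cinner_tuple N g (diag_inv R g)))"

definition tuple_deriv ::
    "(nat \<Rightarrow> 'x::complex_hilbert \<Rightarrow> 'y::complex_hilbert) \<Rightarrow> 'x \<Rightarrow> 'x \<Rightarrow> nat \<Rightarrow> 'y"
  where "tuple_deriv A \<phi> x = (\<lambda>n. frechet_derivative (A n) (at \<phi>) x)"

section \<open>Full data Levenberg--Marquardt iteration\<close>

definition flm_step ::
    "nat \<Rightarrow> (nat \<Rightarrow> 'x::complex_hilbert \<Rightarrow> 'y::complex_hilbert) \<Rightarrow> (nat \<Rightarrow> 'y) \<Rightarrow> ('y \<Rightarrow> 'y) \<Rightarrow>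
     'x \<Rightarrow> real \<Rightarrow> 'x"
  where "flm_step N A f R \<phi> a =
    (let A' = tuple_deriv A \<phi>; A'H = cadjoint_tuple N A' in
      \<phi> + inv (\<lambda>x. a *\<^sub>R x + A'H (diag_inv R (A' x)))
            (A'H (diag_inv R (\<lambda>n. f n - A n \<phi>))))"

primrec flm ::
    "nat \<Rightarrow> (nat \<Rightarrow> 'x::complex_hilbert \<Rightarrow> 'y::complex_hilbert) \<Rightarrow> (nat \<Rightarrow> 'y) \<Rightarrow> ('y \<Rightarrow> 'y) \<Rightarrow>
     (nat \<Rightarrow> real) \<Rightarrow> 'x \<Rightarrow> nat \<Rightarrow> 'x"
  where
    "flm N A f R \<alpha> \<phi>\<^sub>0 0 = \<phi>\<^sub>0"
  | "flm N A f R \<alpha> \<phi>\<^sub>0 (Suc i) = flm_step N A f R (flm N A f R \<alpha> \<phi>\<^sub>0 i) (\<alpha> i)"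

text \<open>Morozov discrepancy principle for the parameter \<open>a\<close> at the iterate \<open>\<phi>\<close>.\<close>

definition morozov ::
    "nat \<Rightarrow> (nat \<Rightarrow> 'x::complex_hilbert \<Rightarrow> 'y::complex_hilbert) \<Rightarrow> (nat \<Rightarrow> 'y) \<Rightarrow> ('y \<Rightarrow> 'y) \<Rightarrow>
     real \<Rightarrow> 'x \<Rightarrow> real \<Rightarrow> bool"
  where "morozov N A f R \<rho> \<phi> a \<longleftrightarrow>
    weighted_norm N R
      (\<lambda>n. f n - A n \<phi> - tuple_deriv A \<phi> (flm_step N A f R \<phi> a - \<phi>) n)
    = \<rho> * weighted_norm N R (\<lambda>n. f n - A n \<phi>)"

section \<open>Kalman filter Levenberg--Marquardt iteration\<close>

text \<open>\<open>D\<close> is the derivative of the current mapping and \<open>B\<close> the preceding weight operator.\<close>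

definition kalman_gain ::
    "('x::complex_hilbert \<Rightarrow> 'y::complex_hilbert) \<Rightarrow> ('y \<Rightarrow> 'y) \<Rightarrow> ('x \<Rightarrow> 'x) \<Rightarrow> 'y \<Rightarrow> 'x"
  where "kalman_gain D R B y = B (cadjoint D (inv (\<lambda>z. R z + D (B (cadjoint D z))) y))"

text \<open>
  The weight operator of outer step \<open>i\<close> depends on \<open>i\<close> only through the parameter \<open>a = \<alpha> i\<close> and the
  linearization point \<open>\<phi> = kfl N A f R \<alpha> \<phi>\<^sub>0 i 0\<close>.
\<close>

primrec kfl_B ::
    "(nat \<Rightarrow> 'x::complex_hilbert \<Rightarrow> 'y::complex_hilbert) \<Rightarrow> ('y \<Rightarrow> 'y) \<Rightarrow> real \<Rightarrow> 'x \<Rightarrow>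
     nat \<Rightarrow> 'x \<Rightarrow> 'x"
  where
    "kfl_B A R a \<phi> 0 = (\<lambda>x. (1 / a) *\<^sub>R x)"
  | "kfl_B A R a \<phi> (Suc n) =
      (let D = frechet_derivative (A (Suc n)) (at \<phi>); B = kfl_B A R a \<phi> n
       in (\<lambda>x. B x - kalman_gain D R B (D (B x))))"

fun kfl ::
    "nat \<Rightarrow> (nat \<Rightarrow> 'x::complex_hilbert \<Rightarrow> 'y::complex_hilbert) \<Rightarrow> (nat \<Rightarrow> 'y) \<Rightarrow> ('y \<Rightarrow> 'y) \<Rightarrow>
     (nat \<Rightarrow> real) \<Rightarrow> 'x \<Rightarrow> nat \<Rightarrow> nat \<Rightarrow> 'x"
  where
    "kfl N A f R \<alpha> \<phi>\<^sub>0 0 0 = \<phi>\<^sub>0"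
  | "kfl N A f R \<alpha> \<phi>\<^sub>0 (Suc i) 0 = kfl N A f R \<alpha> \<phi>\<^sub>0 i N"
  | "kfl N A f R \<alpha> \<phi>\<^sub>0 i (Suc n) =
      (let \<phi> = kfl N A f R \<alpha> \<phi>\<^sub>0 i 0;
           \<psi> = kfl N A f R \<alpha> \<phi>\<^sub>0 i n;
           D = frechet_derivative (A (Suc n)) (at \<phi>);
           K = kalman_gain D R (kfl_B A R (\<alpha> i) \<phi> n)
       in \<psi> + K (f (Suc n) - A (Suc n) \<phi> + D \<phi> - D \<psi>))"

end

theory Submission
  imports Defs
begin

text \<open>
  One outer step linearises at \<open>\<phi>\<close>. Put \<open>D\<^sub>k = A\<^sub>k'[\<phi>]\<close> and \<open>H\<^sub>n = a I + \<Sum>k\<le>n. D\<^sub>k\<^sup>H R\<^sup>-\<^sup>1 D\<^sub>k\<close>.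
  By induction on \<open>n\<close> the Kalman weight is \<open>H\<^sub>n\<^sup>-\<^sup>1\<close>, since \<open>H\<^sub>n B\<^sub>n\<^sub>-\<^sub>1 D\<^sub>n\<^sup>H = D\<^sub>n\<^sup>H R\<^sup>-\<^sup>1 S\<close> for
  \<open>S = R + D\<^sub>n B\<^sub>n\<^sub>-\<^sub>1 D\<^sub>n\<^sup>H\<close>, so that the gain is \<open>H\<^sub>n\<^sup>-\<^sup>1 D\<^sub>n\<^sup>H R\<^sup>-\<^sup>1\<close>; and the \<open>n\<close>th inner iterate solves
  the normal equation \<open>H\<^sub>n (\<psi> - \<phi>) = \<Sum>k\<le>n. D\<^sub>k\<^sup>H R\<^sup>-\<^sup>1 (f\<^sub>k - A\<^sub>k \<phi>)\<close>. For \<open>n = N\<close> this is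
  the full data step. Existence of adjoints and invertibility of \<open>H\<^sub>n\<close> both come from minimising a
  coercive quadratic functional.
\<close>

section \<open>Complex Hilbert spaces\<close>

lemma cinner_add_right: "cinner x (y + z) = cinner x y + cinner (x :: 'a::complex_hilbert) z"
  by (metis cinner_add_left cinner_commute complex_cnj_add)

lemma cinner_scaleC_right: "cinner x (c *\<^sub>C y) = cnj c * cinner (x :: 'a::complex_hilbert) y"
  by (metis cinner_commute cinner_scaleC_left complex_cnj_mult)

lemma cinner_scaleR_left: "cinner (r *\<^sub>R x) y = r *\<^sub>R cinner (x :: 'a::complex_hilbert) y"
  by (metis cinner_scaleC_left scaleC_of_real scaleR_conv_of_real)

lemma cinner_scaleR_right: "cinner x (r *\<^sub>R y) = r *\<^sub>R cinner (x :: 'a::complex_hilbert) y"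
  by (metis cinner_scaleC_right scaleC_of_real scaleR_conv_of_real complex_cnj_complex_of_real)

lemma Re_cinner_commute: "Re (cinner x y) = Re (cinner (y :: 'a::complex_hilbert) x)"
  by (subst cinner_commute) simp

lemma norm_scaleC: "norm (c *\<^sub>C x) = cmod c * norm (x :: 'a::complex_hilbert)"
proof -
  have "complex_of_real ((norm (c *\<^sub>C x))\<^sup>2) = complex_of_real ((cmod c * norm x)\<^sup>2)"
    unfolding cinner_self[symmetric] cinner_scaleC_left cinner_scaleC_right power_mult_distrib
    by (simp add: cinner_self complex_norm_square[of c] mult.assoc
        flip: of_real_power)
  then have "(norm (c *\<^sub>C x))\<^sup>2 = (cmod c * norm x)\<^sup>2"
    by (simp only: of_real_eq_iff)
  then show ?thesis
    by simp
qed

lemma norm_add_square: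
  "(norm (x + y))\<^sup>2 = (norm x)\<^sup>2 + 2 * Re (cinner x y) + (norm (y :: 'a::complex_hilbert))\<^sup>2"
proof -
  have "(norm z)\<^sup>2 = Re (cinner z z)" for z :: 'a
    by (simp add: cinner_self)
  then show ?thesis
    using Re_cinner_commute[of x y] by (simp add: cinner_add_left cinner_add_right)
qed

lemma Re_cinner_le: "Re (cinner x y) \<le> norm x * norm (y :: 'a::complex_hilbert)"
proof (cases "norm x * norm y = 0")
  case True
  then have "x = 0 \<or> y = 0" by auto
  then have "cinner x y = 0"
    using cinner_scaleR_left[of 0 x y] cinner_scaleR_right[of x 0 y] by auto
  then show ?thesis by simp
next
  case False
  let ?a = "norm x" and ?b = "norm y"
  \<comment> \<open>Weighting each vector by the other's norm makes the two squared norms equal, so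
    the expansion factors.\<close>
  have "0 \<le> (norm (?b *\<^sub>R x + (- ?a) *\<^sub>R y))\<^sup>2" by simp
  also have "\<dots> = 2 * (?a * ?b) * (?a * ?b - Re (cinner x y))"
    unfolding norm_add_square cinner_scaleR_left cinner_scaleR_right norm_scaleR
    by (simp add: power2_eq_square algebra_simps)
  finally show ?thesis
    using False by (simp add: zero_le_mult_iff mult_le_0_iff)
qed

lemma cinner_Cauchy_Schwarz: "cmod (cinner x y) \<le> norm x * norm (y :: 'a::complex_hilbert)"
proof (cases "cinner x y = 0")
  case False
  \<comment> \<open>The unimodular factor \<open>c\<close> rotates the scalar product onto its
    modulus and leaves the norm of \<open>x\<close> unchanged, so the bound for real parts
    applies.\<close>
  define c where "c = cnj (sgn (cinner x y))"
  have "cinner (c *\<^sub>C x) y = complex_of_real (cmod (cinner x y))"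
    using False by (simp add: c_def cinner_scaleC_left sgn_eq complex_norm_square[symmetric]
        power2_eq_square mult.commute[of "cnj _"])
  moreover have "norm (c *\<^sub>C x) = norm x"
    using False by (simp add: c_def norm_scaleC norm_sgn)
  ultimately show ?thesis
    using Re_cinner_le[of "c *\<^sub>C x" y] by simp
qed simp

lemma bounded_bilinear_cinner:
  "bounded_bilinear (cinner :: 'a::complex_hilbert \<Rightarrow> 'a \<Rightarrow> complex)"
  by unfold_locales
    (auto simp: cinner_add_left cinner_add_right cinner_scaleR_left cinner_scaleR_right
      intro!: exI[of _ 1] cinner_Cauchy_Schwarz)

interpretation cinner: bounded_bilinear "cinner :: 'a::complex_hilbert \<Rightarrow> 'a \<Rightarrow> complex"
  by (rule bounded_bilinear_cinner)

lemma bounded_clinearD: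
  assumes "bounded_clinear T"
  shows "bounded_linear T" and "T (c *\<^sub>C x) = c *\<^sub>C T x"
  using assms by (auto simp: bounded_clinear_def)

lemma bounded_clinear_id: "bounded_clinear (\<lambda>x. x)"
  by (simp add: bounded_clinear_def)

lemma bounded_clinear_cinner_left:
  assumes "bounded_clinear T"
  shows "bounded_clinear (\<lambda>x. cinner (T x) y)"
  unfolding bounded_clinear_def
  using bounded_linear_compose[OF cinner.bounded_linear_left bounded_clinearD(1)[OF assms]]
  by (simp add: bounded_clinearD(2)[OF assms] cinner_scaleC_left scaleC_complex_def)

section \<open>Minimising a coercive quadratic functional\<close>

text \<open>First-order optimality without calculus: for small t of the right sign a nonzero linear
  term would outweigh the quadratic one.\<close>

lemma linear_term_zero:
  fixes p q :: real
  assumes "\<And>t. 0 \<le> t * p + t\<^sup>2 * q"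
  shows "p = 0"
proof (rule ccontr)
  assume p: "p \<noteq> 0"
  \<comment> \<open>Any positive \<open>s\<close> above \<open>q\<close> makes t = -p/s give a
    negative value; the added 1 keeps \<open>s\<close> positive when \<open>q\<close> is 0.\<close>
  define s where "s = \<bar>q\<bar> + 1"
  have s: "0 < s" "q < s" by (auto simp: s_def)
  have "(- p / s) * p + (- p / s)\<^sup>2 * q = (p / s)\<^sup>2 * (q - s)"
    using s by (simp add: field_simps power2_eq_square)
  also have "\<dots> < 0"
    using s p by (intro mult_pos_neg) auto
  finally show False
    using assms[of "- p / s"] by simp
qed

text \<open>A symmetric Lax-Milgram theorem: u minimises Re(T x, x) - 2 Re(l x). The identity as
  \<open>T\<close> gives Riesz representation, hence adjoints; \<open>l\<close> = (., y) gives a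
  preimage of y under \<open>T\<close>.\<close>

theorem coercive_representation:
  fixes T :: "'a::complex_hilbert \<Rightarrow> 'a" and l :: "'a \<Rightarrow> complex"
  assumes T: "bounded_linear T"
    and sym: "\<And>x y. cinner (T x) y = cinner x (T y)"
    and c: "c > 0" and coercive: "\<And>x. c * (norm x)\<^sup>2 \<le> Re (cinner (T x) x)"
    and l: "bounded_clinear l"
  shows "\<exists>u. \<forall>x. l x = cinner x (T u)"
proof -
  interpret T: bounded_linear T by (rule T)
  interpret l: bounded_linear l by (rule bounded_clinearD(1)[OF l])
  define b where "b x y = Re (cinner (T x) y)" for x y
  define J where "J x = b x x - 2 * Re (l x)" for x
  have b_sym: "b x y = b y x" for x y
    unfolding b_def by (metis sym Re_cinner_commute)
  have b_add: "b (x + y) z = b x z + b y z" "b z (x + y) = b z x + b z y" for x y z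
    by (simp_all add: b_def T.add cinner_add_left cinner_add_right)
  have b_diff: "b (x - y) z = b x z - b y z" "b z (x - y) = b z x - b z y" for x y z
    by (simp_all add: b_def T.diff cinner.diff_left cinner.diff_right)
  have b_scale: "b (r *\<^sub>R x) y = r * b x y" "b x (r *\<^sub>R y) = r * b x y" for r x y
    by (simp_all add: b_def T.scale cinner_scaleR_left cinner_scaleR_right)
  obtain M where M: "\<And>x. cmod (l x) \<le> norm x * M"
    using l.bounded by blast
  \<comment> \<open>Completing the square: c t^2 - 2 M t has minimum -M^2/c over real t.\<close>
  have lower: "- M\<^sup>2 / c \<le> J x" for x
  proof -
    have "Re (l x) \<le> norm x * M"
      using M[of x] complex_Re_le_cmod[of "l x"] by linarith
    then have "c * (norm x)\<^sup>2 - 2 * (norm x * M) \<le> J x"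
      using coercive[of x] by (simp add: J_def b_def)
    moreover have "c * (norm x)\<^sup>2 - 2 * (norm x * M) + M\<^sup>2 / c = (c * norm x - M)\<^sup>2 / c"
      using c by (simp add: field_simps power2_eq_square)
    moreover have "0 \<le> (c * norm x - M)\<^sup>2 / c"
      using c by simp
    ultimately show ?thesis by simp
  qed
  define m where "m = Inf (range J)"
  have bdd: "bdd_below (range J)"
    using lower by (intro bdd_belowI[where m = "- M\<^sup>2 / c"]) auto
  have m_le: "m \<le> J x" for x
    unfolding m_def by (rule cInf_lower[OF _ bdd]) simp
  have "\<exists>x. J x < m + 1 / real (Suc k)" for k
    using cInf_lessD[of "range J" "m + 1 / real (Suc k)"] by (auto simp: m_def)
  then obtain X where X: "\<And>k. J (X k) < m + 1 / real (Suc k)"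
    by metis
  \<comment> \<open>In the parallelogram identity for \<open>b\<close> the linear parts cancel
    against the midpoint, where \<open>J\<close> is at least \<open>m\<close>. Nearly minimal points
    are therefore close together.\<close>
  have parallelogram: "c * (norm (x - y))\<^sup>2 \<le> 2 * (J x - m) + 2 * (J y - m)" for x y
  proof -
    have "b (x - y) (x - y) = 2 * J x + 2 * J y - 4 * J ((1/2) *\<^sub>R (x + y))"
      using b_sym[of y x] unfolding J_def b_diff b_add b_scale l.add l.scale
      by (simp add: algebra_simps)
    then show ?thesis
      using coercive[of "x - y"] m_le[of "(1/2) *\<^sub>R (x + y)"] by (simp add: b_def)
  qed
  have "Cauchy X"
  proof (rule metric_CauchyI)
    fix e :: real assume e: "e > 0"
    \<comment> \<open>Each of the two gaps enters with factor 2, so gaps below c e^2/4 add up to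
      less than c e^2.\<close>
    then obtain K where K: "1 / real (Suc K) < c * e\<^sup>2 / 4"
      using reals_Archimedean[of "c * e\<^sup>2 / 4"] c by (auto simp: inverse_eq_divide)
    have small: "J (X k) - m < c * e\<^sup>2 / 4" if "k \<ge> K" for k
    proof -
      have "1 / real (Suc k) \<le> 1 / real (Suc K)"
        using that by (simp add: frac_le)
      then show ?thesis using X[of k] K by linarith
    qed
    have "dist (X i) (X j) < e" if "i \<ge> K" "j \<ge> K" for i j
    proof -
      have "c * (norm (X i - X j))\<^sup>2 < c * e\<^sup>2"
        using parallelogram[of "X i" "X j"] small[OF that(1)] small[OF that(2)]
        by (simp add: field_simps)
      then have "(norm (X i - X j))\<^sup>2 < e\<^sup>2"
        using c by simp
      then show ?thesis
        using e by (simp add: dist_norm power2_less_imp_less)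
    qed
    then show "\<exists>K. \<forall>i\<ge>K. \<forall>j\<ge>K. dist (X i) (X j) < e" by blast
  qed
  then obtain u where u: "X \<longlonglongrightarrow> u"
    using Cauchy_convergent_iff convergent_def by blast
  have "(\<lambda>k. J (X k)) \<longlonglongrightarrow> J u"
    unfolding J_def b_def
    by (intro tendsto_intros tendsto_Re cinner.tendsto T.tendsto l.tendsto u)
  moreover have "(\<lambda>k. m + 1 / real (Suc k)) \<longlonglongrightarrow> m"
    using LIMSEQ_inverse_real_of_nat_add[of m] by (simp add: inverse_eq_divide)
  ultimately have "J u \<le> m"
    by (rule LIMSEQ_le) (use X less_imp_le in blast)
  then have min: "J u \<le> J x" for x
    using m_le[of x] by linarith
  \<comment> \<open>Along the line through \<open>u\<close> in direction \<open>h\<close> the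
    functional is quadratic in t with minimum at t = 0, so its linear coefficient vanishes.\<close>
  have Re_eq: "Re (l h) = Re (cinner h (T u))" for h
  proof -
    have "J (u + t *\<^sub>R h) - J u = t * (2 * (b u h - Re (l h))) + t\<^sup>2 * b h h" for t
      using b_sym[of h u] unfolding J_def
      by (simp add: b_add b_scale l.add l.scale algebra_simps power2_eq_square)
    then have "2 * (b u h - Re (l h)) = 0"
      by (intro linear_term_zero[where q = "b h h"]) (metis min diff_ge_0_iff_ge)
    then show ?thesis
      by (simp add: b_def Re_cinner_commute[of h])
  qed
  \<comment> \<open>Complex linearity turns the identity for real parts at i h into the one for
    imaginary parts at \<open>h\<close>.\<close>
  have "Im (l h) = Im (cinner h (T u))" for h
    using Re_eq[of "\<i> *\<^sub>C h"]
    by (simp add: bounded_clinearD(2)[OF l] scaleC_complex_def cinner_scaleC_left)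
  then show ?thesis
    using Re_eq by (intro exI[of _ u]) (auto simp: complex_eq_iff)
qed

corollary coercive_bij:
  fixes T :: "'a::complex_hilbert \<Rightarrow> 'a"
  assumes T: "bounded_linear T"
    and sym: "\<And>x y. cinner (T x) y = cinner x (T y)"
    and c: "c > 0" and coercive: "\<And>x. c * (norm x)\<^sup>2 \<le> Re (cinner (T x) x)"
  shows "bij T"
proof (rule bijI)
  interpret T: bounded_linear T by (rule T)
  have "x = 0" if "T x = 0" for x
    using coercive[of x] c that by (simp add: cinner.zero_left mult_le_0_iff)
  then show "inj T"
    by (metis injI T.diff eq_iff_diff_eq_0)
  show "surj T"
  proof (unfold surj_def, intro allI)
    fix y
    obtain u where "\<forall>x. cinner x y = cinner x (T u)"
      using coercive_representation[OF T sym c coercive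
          bounded_clinear_cinner_left[OF bounded_clinear_id]] by blast
    then show "\<exists>x. y = T x"
      using cinner_eqI[of y "T u"] by blast
  qed
qed

section \<open>Adjoints\<close>

text \<open>The description \<open>THE\<close> in \<open>adjoint_wrt\<close> is only meaningful once
  an adjoint exists; Riesz representation supplies one.\<close>

lemma cinner_cadjoint:
  assumes "bounded_clinear T"
  shows "cinner (T x) y = cinner x (cadjoint T y)"
proof -
  have "\<exists>u. \<forall>x. cinner (T x) y = cinner x u" for y
    using coercive_representation[OF bounded_linear_ident refl zero_less_one _
        bounded_clinear_cinner_left[OF assms]] by (simp add: cinner_self)
  then obtain S where S: "\<And>x y. cinner (T x) y = cinner x (S y)"
    by metis
  then have "cadjoint T = S"
    by (rule adjoint_wrt_eqI)
  then show ?thesis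
    using S by simp
qed

lemma bounded_linear_cadjoint:
  assumes "bounded_clinear T"
  shows "bounded_linear (cadjoint T)"
proof -
  interpret T: bounded_linear T by (rule bounded_clinearD(1)[OF assms])
  note adj = cinner_cadjoint[OF assms, symmetric]
  obtain K where K: "0 < K" "\<And>x. norm (T x) \<le> norm x * K"
    using T.pos_bounded by blast
  show ?thesis
  proof (rule bounded_linear_intro)
    show "cadjoint T (x + y) = cadjoint T x + cadjoint T y" for x y
      by (rule cinner_eqI) (simp add: cinner_add_right adj)
    show "cadjoint T (r *\<^sub>R x) = r *\<^sub>R cadjoint T x" for r x
      by (rule cinner_eqI) (simp add: cinner_scaleR_right adj)
    show "norm (cadjoint T y) \<le> norm y * K" for y
    proof (cases "cadjoint T y = 0")
      case False
      \<comment> \<open>One factor of the squared norm cancels at the end, leaving the bound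
        \<open>K\<close> of \<open>T\<close>.\<close>
      have "(norm (cadjoint T y))\<^sup>2 = Re (cinner (cadjoint T y) (cadjoint T y))"
        by (simp add: cinner_self)
      also have "\<dots> = Re (cinner (T (cadjoint T y)) y)"
        by (simp add: adj)
      also have "\<dots> \<le> norm (T (cadjoint T y)) * norm y"
        by (rule Re_cinner_le)
      also have "\<dots> \<le> (norm (cadjoint T y) * K) * norm y"
        by (intro mult_right_mono K) simp
      finally show ?thesis
        using False by (simp add: power2_eq_square mult.assoc mult.commute[of K])
    qed (use K in simp)
  qed
qed

text \<open>Derivatives at a point are unique, so the library's choice is the complex linear
  witness.\<close>

lemma bounded_clinear_frechet_derivative:
  assumes "cfrechet_differentiable F x"
  shows "bounded_clinear (frechet_derivative F (at x))"
  using assms frechet_derivative_at unfolding cfrechet_differentiable_def by metis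

section \<open>Kalman updates of the regularised normal operator\<close>

text \<open>Cutting the sum at \<open>n\<close> yields the chain of operators from a I, at
  \<open>n\<close> = 0, up to the full data operator. \<open>Q\<close> stands for the inverse of
  \<open>R\<close>.\<close>

definition normal_op ::
    "(nat \<Rightarrow> 'x::complex_hilbert \<Rightarrow> 'y::complex_hilbert) \<Rightarrow> ('y \<Rightarrow> 'y) \<Rightarrow> real \<Rightarrow> nat \<Rightarrow> 'x \<Rightarrow> 'x"
  where "normal_op D Q a n x = a *\<^sub>R x + (\<Sum>k = 1..n. cadjoint (D k) (Q (D k x)))"

lemma normal_op_Suc:
  "normal_op D Q a (Suc n) x = normal_op D Q a n x + cadjoint (D (Suc n)) (Q (D (Suc n) x))"
  by (simp add: normal_op_def add.assoc)

section \<open>Normal operators weighted by the inverse covariance\<close>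

locale covariance =
  fixes R :: "'y::complex_hilbert \<Rightarrow> 'y"
  assumes R: "bounded_clinear R" and R_self_adjoint: "cadjoint R = R"
    and R_pos_def: "positive_definite R"
    and bij_R: "bij R" and R_inv: "bounded_clinear (inv R)"
begin

lemma R_inv_R [simp]: "R (inv R y) = y" "inv R (R y) = y"
  using bij_R by (simp_all add: bij_is_surj surj_f_inv_f bij_is_inj)

lemma inv_R_sym: "cinner (inv R x) y = cinner x (inv R y)"
  using cinner_cadjoint[OF R, of "inv R x" "inv R y"] by (simp add: R_self_adjoint)

lemma inv_R_nonneg: "0 \<le> Re (cinner (inv R y) y)"
proof (cases "inv R y = 0")
  case False
  \<comment> \<open>Substituting y = R z turns the form of the inverse at y into the form of
    \<open>R\<close> at z.\<close>
  then have "0 < Re (cinner (R (inv R y)) (inv R y))"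
    using R_pos_def unfolding positive_definite_def by blast
  then show ?thesis
    by (simp add: Re_cinner_commute[of y])
qed (simp add: cinner.zero_left)

lemma bounded_linear_normal_op:
  assumes "\<And>k. k \<in> {1..n} \<Longrightarrow> bounded_clinear (D k)"
  shows "bounded_linear (normal_op D (inv R) a n)"
  unfolding normal_op_def[abs_def]
  by (intro bounded_linear_add bounded_linear_scaleR_right bounded_linear_sum
      bounded_linear_compose[OF bounded_linear_cadjoint]
      bounded_linear_compose[OF bounded_clinearD(1)[OF R_inv]] bounded_clinearD(1) assms)

text \<open>Every summand contributes a nonnegative form, so the regularization parameter itself is
  a coercivity constant.\<close>

lemma bij_normal_op:
  assumes D: "\<And>k. k \<in> {1..n} \<Longrightarrow> bounded_clinear (D k)" and a: "a > 0"
  shows "bij (normal_op D (inv R) a n)"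
proof (rule coercive_bij[OF bounded_linear_normal_op[OF D] _ a])
  let ?H = "normal_op D (inv R) a n"
  have left: "cinner (?H x) y = a *\<^sub>R cinner x y + (\<Sum>k = 1..n. cinner (inv R (D k x)) (D k y))"
    for x y
  proof -
    have "cinner (cadjoint (D k) z) y = cinner z (D k y)" if "k \<in> {1..n}" for k z
      using cinner_cadjoint[OF D[OF that], of y z] by (metis cinner_commute)
    then show ?thesis
      by (simp add: normal_op_def cinner_add_left cinner_scaleR_left cinner.sum_left)
  qed
  show "cinner (?H x) y = cinner x (?H y)" for x y
  proof -
    have "cinner x (?H y) = cnj (cinner (?H y) x)"
      by (rule cinner_commute)
    also have "\<dots> = a *\<^sub>R cinner x y + (\<Sum>k = 1..n. cinner (D k x) (inv R (D k y)))"
      by (simp add: left cinner_commute[symmetric] scaleR_conv_of_real)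
    also have "\<dots> = cinner (?H x) y"
      by (simp add: left inv_R_sym)
    finally show ?thesis ..
  qed
  show "a * (norm x)\<^sup>2 \<le> Re (cinner (?H x) x)" for x
    by (simp add: left cinner_self sum_nonneg inv_R_nonneg)
qed

text \<open>Sherman--Morrison--Woodbury, where \<open>H\<close> and \<open>H'\<close> are consecutive normal operators.\<close>

lemma
  fixes H H' :: "'x::complex_hilbert \<Rightarrow> 'x" and D :: "'x \<Rightarrow> 'y"
  assumes D: "bounded_clinear D"
    and H: "bij H" and H': "bij H'" "bounded_linear H'"
    and step: "\<And>x. H' x = H x + cadjoint D (inv R (D x))"
  shows normal_op_kalman_gain: "H' (kalman_gain D R (inv H) y) = cadjoint D (inv R y)" (is ?gain)
    and inv_normal_op_step: "inv H x - kalman_gain D R (inv H) (D (inv H x)) = inv H' x" (is ?inv)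
proof -
  interpret Q: bounded_linear "inv R" by (rule bounded_clinearD(1)[OF R_inv])
  interpret DH: bounded_linear "cadjoint D" by (rule bounded_linear_cadjoint[OF D])
  interpret H': bounded_linear H' by (rule H')
  have [simp]: "H (inv H x) = x" "inv H (H x) = x" for x
    using H by (simp_all add: bij_is_surj surj_f_inv_f bij_is_inj)
  have [simp]: "H' (inv H' x) = x" "inv H' (H' x) = x" for x
    using H' by (simp_all add: bij_is_surj surj_f_inv_f bij_is_inj)
  define S where "S z = R z + D (inv H (cadjoint D z))" for z
  have H'_S: "H' (inv H (cadjoint D z)) = cadjoint D (inv R (S z))" for z
    by (simp add: step S_def Q.add DH.add)
  \<comment> \<open>Surjectivity makes \<open>inv S\<close> a right inverse, as the gain requires.
    The preimage is guessed from the expected gain: \<open>w\<close> is what the gain should make of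
    \<open>y\<close>, and \<open>inv R (y - D w)\<close> is then sent to \<open>y\<close>.\<close>
  have "surj S"
  proof (unfold surj_def, intro allI)
    fix y
    define w where "w = inv H' (cadjoint D (inv R y))"
    have "cadjoint D (inv R (y - D w)) = H' w - cadjoint D (inv R (D w))"
      by (simp add: w_def Q.diff DH.diff)
    also have "\<dots> = H w"
      by (simp add: step)
    finally have "S (inv R (y - D w)) = y"
      by (simp add: S_def)
    then show "\<exists>z. y = S z" by metis
  qed
  then have "S (inv S y) = y" for y
    by (rule surj_f_inv_f)
  then have gain: "H' (kalman_gain D R (inv H) y) = cadjoint D (inv R y)" for y
    using H'_S[of "inv S y"] by (simp add: kalman_gain_def S_def[abs_def])
  then show ?gain .
  \<comment> \<open>The increment from \<open>H\<close> to \<open>H'\<close> at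
    \<open>inv H x\<close> is exactly what the gain term subtracts.\<close>
  have "H' (inv H x - kalman_gain D R (inv H) (D (inv H x))) = x"
    by (simp add: H'.diff gain step[of "inv H x"])
  then show ?inv
    using H' by (metis bij_is_inj inv_f_eq)
qed

section \<open>The inner Kalman recursion\<close>

lemma kfl_B_eq_inv:
  fixes A :: "nat \<Rightarrow> 'x::complex_hilbert \<Rightarrow> 'y"
  assumes D: "\<And>k. k \<in> {1..n} \<Longrightarrow> bounded_clinear (frechet_derivative (A k) (at \<phi>))"
    and a: "a > 0"
  shows "kfl_B A R a \<phi> n = inv (normal_op (\<lambda>k. frechet_derivative (A k) (at \<phi>)) (inv R) a n)"
  using D
proof (induction n)
  case 0
  have "inv (\<lambda>x. a *\<^sub>R x) = (\<lambda>x::'x. (1 / a) *\<^sub>R x)"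
    by (rule inv_equality) (use a in auto)
  then show ?case
    by (simp add: normal_op_def[abs_def])
next
  case (Suc n)
  let ?D = "\<lambda>k. frechet_derivative (A k) (at \<phi>)"
  let ?H = "normal_op ?D (inv R) a"
  have "kfl_B A R a \<phi> n = inv (?H n)"
    by (rule Suc.IH) (use Suc.prems in auto)
  moreover have "inv (?H n) x - kalman_gain (?D (Suc n)) R (inv (?H n)) (?D (Suc n) (inv (?H n) x))
      = inv (?H (Suc n)) x" for x
    by (rule inv_normal_op_step[OF _ bij_normal_op bij_normal_op bounded_linear_normal_op
          normal_op_Suc])
      (use Suc.prems a in auto)
  ultimately show ?case
    by (simp add: Let_def)
qed

lemma normal_op_kfl:
  fixes N :: nat and A :: "nat \<Rightarrow> 'x::complex_hilbert \<Rightarrow> 'y" and f \<alpha> \<phi>\<^sub>0 i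
  defines "\<phi> \<equiv> kfl N A f R \<alpha> \<phi>\<^sub>0 i 0"
  defines "D \<equiv> \<lambda>k. frechet_derivative (A k) (at \<phi>)"
  assumes D: "\<And>k. k \<in> {1..n} \<Longrightarrow> bounded_clinear (D k)" and a: "\<alpha> i > 0"
  shows "normal_op D (inv R) (\<alpha> i) n (kfl N A f R \<alpha> \<phi>\<^sub>0 i n - \<phi>)
    = (\<Sum>k = 1..n. cadjoint (D k) (inv R (f k - A k \<phi>)))"
  using D
proof (induction n)
  case 0
  show ?case
    by (simp add: normal_op_def \<phi>_def)
next
  case (Suc n)
  let ?H = "normal_op D (inv R) (\<alpha> i)" and ?D = "D (Suc n)"
  let ?r = "\<lambda>k. f k - A k \<phi>"
  define d where "d = kfl N A f R \<alpha> \<phi>\<^sub>0 i n - \<phi>"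
  interpret H: bounded_linear "?H (Suc n)"
    by (rule bounded_linear_normal_op[OF Suc.prems])
  interpret Q: bounded_linear "inv R" by (rule bounded_clinearD(1)[OF R_inv])
  interpret D: bounded_linear ?D by (intro bounded_clinearD(1) Suc.prems) simp
  interpret DH: bounded_linear "cadjoint ?D" by (intro bounded_linear_cadjoint Suc.prems) simp
  have D_eq: "frechet_derivative (A k) (at \<phi>) = D k" for k
    by (simp add: D_def)
  have B: "kfl_B A R (\<alpha> i) \<phi> n = inv (?H n)"
    unfolding D_def by (rule kfl_B_eq_inv) (use Suc.prems a in \<open>auto simp: D_def\<close>)
  \<comment> \<open>Measured from the linearization point, the innovation becomes the residual minus
    \<open>?D d\<close>.\<close>
  have "kfl N A f R \<alpha> \<phi>\<^sub>0 i (Suc n) - \<phi> = d + kalman_gain ?D R (inv (?H n)) (?r (Suc n) - ?D d)"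
    by (simp only: kfl.simps Let_def \<phi>_def[symmetric] D_eq B d_def D.diff)
      (simp add: algebra_simps)
  moreover have "?H (Suc n) (kalman_gain ?D R (inv (?H n)) y) = cadjoint ?D (inv R y)" for y
    by (rule normal_op_kalman_gain[OF _ bij_normal_op bij_normal_op bounded_linear_normal_op
          normal_op_Suc])
      (use Suc.prems a in auto)
  ultimately have "?H (Suc n) (kfl N A f R \<alpha> \<phi>\<^sub>0 i (Suc n) - \<phi>)
      = ?H (Suc n) d + cadjoint ?D (inv R (?r (Suc n) - ?D d))"
    by (simp only: H.add)
  \<comment> \<open>The part \<open>- ?D d\<close> of the innovation cancels the term by which
    \<open>?H (Suc n) d\<close> exceeds \<open>?H n d\<close>.\<close>
  also have "\<dots> = ?H n d + cadjoint ?D (inv R (?r (Suc n)))"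
    by (simp only: normal_op_Suc Q.diff DH.diff) simp
  also have "?H n d = (\<Sum>k = 1..n. cadjoint (D k) (inv R (?r k)))"
    unfolding d_def by (rule Suc.IH) (use Suc.prems in auto)
  finally show ?case
    by simp
qed

section \<open>The full data step and the comparison of the iterations\<close>

text \<open>The adjoint of a tuple of operators is the sum of the componentwise adjoints, by
  uniqueness of adjoints; this brings the step into normal operator form.\<close>

lemma flm_step_eq:
  fixes A :: "nat \<Rightarrow> 'x::complex_hilbert \<Rightarrow> 'y" and \<phi>
  defines "D \<equiv> \<lambda>k. frechet_derivative (A k) (at \<phi>)"
  assumes D: "\<And>k. k \<in> {1..N} \<Longrightarrow> bounded_clinear (D k)"
  shows "flm_step N A f R \<phi> a
    = \<phi> + inv (normal_op D (inv R) a N) (\<Sum>k = 1..N. cadjoint (D k) (inv R (f k - A k \<phi>)))"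
proof -
  have "cadjoint_tuple N (tuple_deriv A \<phi>) = (\<lambda>g. \<Sum>k = 1..N. cadjoint (D k) (g k))"
    by (rule adjoint_wrt_eqI)
      (simp add: cinner_tuple_def tuple_deriv_def D_def cinner.sum_right
        cinner_cadjoint[OF D[unfolded D_def]])
  then show ?thesis
    by (simp add: flm_step_def Let_def diag_inv_def tuple_deriv_def normal_op_def[abs_def]
        D_def)
qed

lemma kfl_eq_flm_step:
  assumes diff: "\<And>n. n \<in> {1..N} \<Longrightarrow> cfrechet_differentiable (A n) (kfl N A f R \<alpha> \<phi>\<^sub>0 i 0)"
    and a: "\<alpha> i > 0"
  shows "kfl N A f R \<alpha> \<phi>\<^sub>0 i N = flm_step N A f R (kfl N A f R \<alpha> \<phi>\<^sub>0 i 0) (\<alpha> i)"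
proof -
  define \<phi> where "\<phi> = kfl N A f R \<alpha> \<phi>\<^sub>0 i 0"
  let ?H = "normal_op (\<lambda>k. frechet_derivative (A k) (at \<phi>)) (inv R) (\<alpha> i) N"
  have D: "bounded_clinear (frechet_derivative (A k) (at \<phi>))" if "k \<in> {1..N}" for k
    using diff[OF that] by (simp add: \<phi>_def bounded_clinear_frechet_derivative)
  have "?H (kfl N A f R \<alpha> \<phi>\<^sub>0 i N - \<phi>)
      = (\<Sum>k = 1..N. cadjoint (frechet_derivative (A k) (at \<phi>)) (inv R (f k - A k \<phi>)))"
    unfolding \<phi>_def by (rule normal_op_kfl[OF D[unfolded \<phi>_def] a])
  then have "flm_step N A f R \<phi> (\<alpha> i) = \<phi> + inv ?H (?H (kfl N A f R \<alpha> \<phi>\<^sub>0 i N - \<phi>))"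
    by (simp only: flm_step_eq[OF D])
  also have "\<dots> = kfl N A f R \<alpha> \<phi>\<^sub>0 i N"
    using bij_normal_op[OF D a] by (simp add: bij_is_inj)
  finally have "kfl N A f R \<alpha> \<phi>\<^sub>0 i N = flm_step N A f R \<phi> (\<alpha> i)" ..
  then show ?thesis
    by (simp only: \<phi>_def)
qed

end

theorem theorem4p2:
  fixes N :: nat
    and f :: "nat \<Rightarrow> 'y::complex_hilbert"
    and A :: "nat \<Rightarrow> 'x::complex_hilbert \<Rightarrow> 'y"
    and R :: "'y \<Rightarrow> 'y"
    and \<phi>\<^sub>0 :: 'x
    and \<alpha> :: "nat \<Rightarrow> real"
    and \<rho> :: real
  assumes N: "N \<ge> 1"
    and R_bounded: "bounded_clinear R"
    and R_self_adjoint: "cadjoint R = R"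
    and R_pos_def: "positive_definite R"
    and R_inverse: "bij R" "bounded_clinear (inv R)"
    and rho: "0 < \<rho>" "\<rho> < 1"
    and alpha_pos: "\<And>i. \<alpha> i > 0"
    and alpha_morozov: "\<And>i. i \<ge> 1 \<Longrightarrow> morozov N A f R \<rho> (flm N A f R \<alpha> \<phi>\<^sub>0 i) (\<alpha> i)"
    and diff_flm: "\<And>i n. n \<in> {1..N} \<Longrightarrow> cfrechet_differentiable (A n) (flm N A f R \<alpha> \<phi>\<^sub>0 i)"
    and diff_kfl: "\<And>i n. n \<in> {1..N} \<Longrightarrow> cfrechet_differentiable (A n) (kfl N A f R \<alpha> \<phi>\<^sub>0 i 0)"
  shows "\<forall>i. kfl N A f R \<alpha> \<phi>\<^sub>0 i N = flm N A f R \<alpha> \<phi>\<^sub>0 (Suc i)"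
proof -
  interpret covariance R
    by unfold_locales fact+
  have step: "kfl N A f R \<alpha> \<phi>\<^sub>0 i N = flm_step N A f R (kfl N A f R \<alpha> \<phi>\<^sub>0 i 0) (\<alpha> i)" for i
    by (rule kfl_eq_flm_step[where \<alpha> = \<alpha>, OF diff_kfl alpha_pos])
  \<comment> \<open>The Kalman iteration starts each new outer step from its last inner iterate, so
    agreement at the start of step i passes through \<open>step\<close> to step i + 1.\<close>
  have "kfl N A f R \<alpha> \<phi>\<^sub>0 i 0 = flm N A f R \<alpha> \<phi>\<^sub>0 i" for i
    by (induction i) (simp_all add: step)
  then show ?thesis
    by (simp add: step)
qed

end
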